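(* For every integer $n\ge 4$, player 1 has a winning strategy in the transversal $n$-game; that is, with optimal play by both players, the transversal $n$-game is a win for player 1.
   Context: A transversal of an $n\times n$ grid is a set of $n$ cells no two of which lie in the same row or the same column. The transversal $n$-game is played on an $n\times n$ grid by two players who alternate moves, player 1 moving first. On each move, the player to move claims one currently unoccupied cell (player 1 marks it $X$, player 2 marks it $O$). The first player (if any) to have claimed all $n$ cells of some transversal wins. If the grid becomes completely filled and neither player has claimed a transversal, the game is a draw. *)

theory Defs
  imports Main
begin

type_synonym cell = "nat \<times> nat"

definition grid :: "nat \<Rightarrow> cell set" where
  "grid n = {..<n} \<times> {..<n}"

definition transversal :: "nat \<Rightarrow> cell set \<Rightarrow> bool" where
  "transversal n T \<longleftrightarrow> T \<subseteq> grid n \<and> card T = n \<and> inj_on fst T \<and> inj_on snd T"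

definition has_transversal :: "nat \<Rightarrow> cell set \<Rightarrow> bool" where
  "has_transversal n S \<longleftrightarrow> (\<exists>T\<subseteq>S. transversal n T)"

text \<open>win1 n p1_to_move Xs Os: from the position with Xs-cells Xs and Os-cells Os (no one has
  won yet), with player 1 to move iff p1_to_move, player 1 can force a win
  (in finitely many moves, as the least fixed point).\<close>
inductive win1 :: "nat \<Rightarrow> bool \<Rightarrow> cell set \<Rightarrow> cell set \<Rightarrow> bool" for n where
  win_now: "c \<in> grid n - (Xs \<union> Os) \<Longrightarrow> has_transversal n (insert c Xs) \<Longrightarrow> win1 n True Xs Os"
| move1: "c \<in> grid n - (Xs \<union> Os) \<Longrightarrow> win1 n False (insert c Xs) Os \<Longrightarrow> win1 n True Xs Os"
| move2: "grid n - (Xs \<union> Os) \<noteq> {} \<Longrightarrow>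
          (\<forall>c\<in>grid n - (Xs \<union> Os). \<not> has_transversal n (insert c Os) \<and> win1 n True Xs (insert c Os))
          \<Longrightarrow> win1 n False Xs Os"

end

theory Submission
  imports Defs
begin

text \<open>
  Player 1 builds a partial transversal, always playing in the row of player 2's last move if that
  row is still unused, so that the unused rows contain no O after each of his moves. Meanwhile he
  leaves unused a column that already contains an O; if in the end it contains every O, he plays in
  it, because those O cells then block one another. When a single cell \<open>(a, b)\<close> is missing,
  player 2 has to take it, after which \<open>(a, g r)\<close> forces the reply \<open>(r, b)\<close>, where \<open>g\<close> is the
  partial transversal. These forced moves leave the O cells in so few columns that player 2 cannot
  finish before player 1 has carried out a double threat in column \<open>b\<close>.
\<close>

section \<open>Criteria for containing a transversal\<close>

text \<open>A transversal uses \<open>n\<close> different columns. Every proof below that player 2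
  has not yet won rests on this count.\<close>

lemma no_transversal_few_columns:
  assumes "finite S" "card (snd ` S) < n"
  shows "\<not> has_transversal n S"
proof
  assume "has_transversal n S"
  then obtain T where T: "T \<subseteq> S" "card T = n" "inj_on snd T"
    by (auto simp: has_transversal_def transversal_def)
  have "card T = card (snd ` T)" using T(3) by (simp add: card_image)
  also have "\<dots> \<le> card (snd ` S)" using T(1) assms(1) by (simp add: card_mono image_mono)
  finally show False using T(2) assms(2) by simp
qed

lemma has_transversalI:
  assumes "inj_on h {..<n}" "\<And>r. r < n \<Longrightarrow> h r < n" "\<And>r. r < n \<Longrightarrow> (r, h r) \<in> S"
  shows "has_transversal n S"
  unfolding has_transversal_def transversal_def
proof (intro exI conjI)
  let ?T = "(\<lambda>r. (r, h r)) ` {..<n}"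
  show "?T \<subseteq> S" "?T \<subseteq> grid n" using assms(2,3) by (auto simp: grid_def)
  show "card ?T = n" by (simp add: card_image inj_on_def)
  show "inj_on fst ?T" by (auto simp: inj_on_def)
  show "inj_on snd ?T" using assms(1) by (auto simp: inj_on_def)
qed

section \<open>Transposing the grid\<close>

lemma has_transversal_swap:
  assumes "has_transversal n S"
  shows "has_transversal n (prod.swap ` S)"
proof -
  from assms obtain T where T: "T \<subseteq> S" "T \<subseteq> grid n" "card T = n" "inj_on fst T" "inj_on snd T"
    by (auto simp: has_transversal_def transversal_def)
  have "inj_on fst (prod.swap ` T)" "inj_on snd (prod.swap ` T)" "prod.swap ` T \<subseteq> grid n"
    using T(2,4,5) by (auto simp: inj_on_def grid_def)
  moreover have "card (prod.swap ` T) = n" using T(3) by (simp add: card_image)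
  ultimately have "transversal n (prod.swap ` T)" by (simp add: transversal_def)
  then show ?thesis using image_mono[OF T(1), of prod.swap] by (auto simp: has_transversal_def)
qed

lemma grid_swap_iff: "prod.swap c \<in> grid n \<longleftrightarrow> c \<in> grid n"
  by (cases c) (auto simp: grid_def)

lemma swap_in_swap_image_iff: "prod.swap c \<in> prod.swap ` S \<longleftrightarrow> c \<in> S"
  by (simp add: inj_image_mem_iff)

text \<open>Transposition preserves the grid, the free cells and the transversals, hence every rule
  of the game. It is needed when player 2 first replies in the column of the first X.\<close>

lemma win1_swap:
  "win1 n t Xs Os \<Longrightarrow> win1 n t (prod.swap ` Xs) (prod.swap ` Os)"
proof (induction rule: win1.induct)
  case (win_now c Xs Os)
  have "prod.swap c \<in> grid n - (prod.swap ` Xs \<union> prod.swap ` Os)"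
    using win_now(1) by (simp add: grid_swap_iff swap_in_swap_image_iff)
  moreover have "has_transversal n (insert (prod.swap c) (prod.swap ` Xs))"
    using has_transversal_swap[OF win_now(2)] by simp
  ultimately show ?case by (rule win1.win_now)
next
  case (move1 c Xs Os)
  have "prod.swap c \<in> grid n - (prod.swap ` Xs \<union> prod.swap ` Os)"
    using move1(1) by (simp add: grid_swap_iff swap_in_swap_image_iff)
  moreover have "win1 n False (insert (prod.swap c) (prod.swap ` Xs)) (prod.swap ` Os)"
    using move1(3) by simp
  ultimately show ?case by (rule win1.move1)
next
  case (move2 Xs Os)
  have free: "c \<in> grid n - (prod.swap ` Xs \<union> prod.swap ` Os) \<longleftrightarrow>
      prod.swap c \<in> grid n - (Xs \<union> Os)" for c
    using swap_in_swap_image_iff[of "prod.swap c"] by (simp add: grid_swap_iff)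
  show ?case
  proof (rule win1.move2)
    obtain c where "c \<in> grid n - (Xs \<union> Os)" using move2(1) by blast
    then have "prod.swap c \<in> grid n - (prod.swap ` Xs \<union> prod.swap ` Os)" using free by simp
    then show "grid n - (prod.swap ` Xs \<union> prod.swap ` Os) \<noteq> {}" by blast
  next
    show "\<forall>c\<in>grid n - (prod.swap ` Xs \<union> prod.swap ` Os).
        \<not> has_transversal n (insert c (prod.swap ` Os)) \<and>
        win1 n True (prod.swap ` Xs) (insert c (prod.swap ` Os))"
    proof (intro ballI conjI notI)
      fix c assume c: "c \<in> grid n - (prod.swap ` Xs \<union> prod.swap ` Os)"
      then have c': "prod.swap c \<in> grid n - (Xs \<union> Os)" using free by blast
      show "win1 n True (prod.swap ` Xs) (insert c (prod.swap ` Os))"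
        using bspec[OF move2(2) c'] by simp
      assume "has_transversal n (insert c (prod.swap ` Os))"
      from has_transversal_swap[OF this]
      have "has_transversal n (insert (prod.swap c) Os)" by (simp add: image_image)
      then show False using bspec[OF move2(2) c'] by simp
    qed
  qed
qed

section \<open>Partial transversals as graphs of functions\<close>

definition graph_on :: "(nat \<Rightarrow> nat) \<Rightarrow> nat set \<Rightarrow> cell set" where
  "graph_on g A = (\<lambda>r. (r, g r)) ` A"

lemma mem_graph_on [simp]: "(r, c) \<in> graph_on g A \<longleftrightarrow> r \<in> A \<and> c = g r"
  by (auto simp: graph_on_def)

lemma graph_on_upd: "a \<notin> A \<Longrightarrow> insert (a, y) (graph_on g A) = graph_on (g(a := y)) (insert a A)"
  by (auto simp: graph_on_def)

section \<open>The endgame with one missing cell\<close>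

lemma card_snd_insert_le: "finite S \<Longrightarrow> card (snd ` insert c S) \<le> Suc (card (snd ` S))"
  by (simp add: card_insert_if)

text \<open>The bound on the number of columns costs player 2 the two tempi that the double threat
  needs.\<close>

lemma win1_one_missing:
  assumes g: "inj_on g ({..<n} - {a})" "g ` ({..<n} - {a}) = {..<n} - {b}"
    and ab: "a < n" "b < n" "(a, b) \<notin> F"
    and F: "finite F" "card (insert b (snd ` F)) + 2 \<le> n"
    and r: "r1 < n" "r2 < n" "r1 \<noteq> a" "r2 \<noteq> a" "r1 \<noteq> r2"
    and free: "(a, g r1) \<notin> F" "(r1, b) \<notin> F" "(r2, b) \<notin> F" "(a, g r2) \<notin> F" "(r1, g r2) \<notin> F"
  shows "win1 n False (graph_on g ({..<n} - {a})) F"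
proof -
  let ?X = "graph_on g ({..<n} - {a})"
  let ?X1 = "insert (a, g r1) ?X"
  let ?X2 = "insert (r2, b) ?X1"
  let ?O1 = "insert (a, b) F"
  let ?O2 = "insert (r1, b) ?O1"
  have gb: "g r \<noteq> b \<and> g r < n" if "r < n" "r \<noteq> a" for r
    using g(2) that by (metis DiffE DiffI image_eqI insertI1 lessThan_iff singletonD)
  have ginj: "g r = g s \<longleftrightarrow> r = s" if "r < n" "r \<noteq> a" "s < n" "s \<noteq> a" for r s
    using g(1) that by (auto simp: inj_on_def)
  note gr = gb[OF r(1,3)] gb[OF r(2,4)] ginj[OF r(1,3) r(2,4)]
  \<comment> \<open>\<open>T0\<close> to \<open>T3\<close> are the threats in order of play.
    \<open>T0\<close> completes \<open>g\<close> itself. In \<open>T1\<close>, row \<open>a\<close>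
    has taken over column \<open>g r1\<close>, so row \<open>r1\<close> needs \<open>b\<close>. Once
    \<open>r2\<close> holds \<open>b\<close>, column \<open>g r2\<close> is left over:
    \<open>T2\<close> gives it to \<open>a\<close> and leaves \<open>r1\<close> alone,
    \<open>T3\<close> gives it to \<open>r1\<close> while \<open>a\<close> uses
    \<open>g r1\<close>.\<close>
  have T0: "has_transversal n (insert (a, b) ?X)"
  proof (rule has_transversalI[where h = "g(a := b)"])
    show "inj_on (g(a := b)) {..<n}" using gb ginj by (auto simp: inj_on_def)
  qed (use gb ab in auto)
  have T1: "has_transversal n (insert (r1, b) ?X1)"
  proof (rule has_transversalI[where h = "g(a := g r1, r1 := b)"])
    show "inj_on (g(a := g r1, r1 := b)) {..<n}" using gb ginj r by (auto simp: inj_on_def)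
  qed (use gb ab r in auto)
  have T2: "has_transversal n (insert (a, g r2) ?X2)"
  proof (rule has_transversalI[where h = "g(a := g r2, r2 := b)"])
    show "inj_on (g(a := g r2, r2 := b)) {..<n}" using gb ginj r by (auto simp: inj_on_def)
  qed (use gb ab r in auto)
  have T3: "has_transversal n (insert (r1, g r2) ?X2)"
  proof (rule has_transversalI[where h = "g(a := g r1, r1 := g r2, r2 := b)"])
    show "inj_on (g(a := g r1, r1 := g r2, r2 := b)) {..<n}"
      using gb ginj r by (auto simp: inj_on_def)
  qed (use gb ab r in auto)
  \<comment> \<open>The forced replies \<open>(a, b)\<close> and \<open>(r1, b)\<close> share column
    \<open>b\<close>, so up to each free choice of player 2 the O cells stay in at most
    \<open>n - 2\<close> columns, and that choice adds at most one more.\<close>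
  have no_O: "\<not> has_transversal n (insert c S)"
    if "finite S" "snd ` S \<subseteq> insert b (snd ` F)" for S c
  proof (rule no_transversal_few_columns)
    have "card (snd ` S) \<le> card (insert b (snd ` F))" using that F(1) by (intro card_mono) auto
    then show "card (snd ` insert c S) < n"
      using card_snd_insert_le[OF that(1), of c] F(2) by linarith
  qed (use that in simp)
  \<comment> \<open>The double threat: \<open>T2\<close> and \<open>T3\<close> need different free
    cells, and player 2 can take only one of them.\<close>
  have win3: "win1 n False ?X2 ?O2"
  proof (rule win1.move2)
    have f1: "(a, g r2) \<in> grid n - (?X2 \<union> ?O2)" and f2: "(r1, g r2) \<in> grid n - (?X2 \<union> ?O2)"
      using r gr free ab by (auto simp: grid_def)
    then show "grid n - (?X2 \<union> ?O2) \<noteq> {}" by blast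
    show "\<forall>c\<in>grid n - (?X2 \<union> ?O2). \<not> has_transversal n (insert c ?O2) \<and>
        win1 n True ?X2 (insert c ?O2)"
    proof (intro ballI conjI)
      fix c
      show "\<not> has_transversal n (insert c ?O2)" using F(1) by (intro no_O) auto
      show "win1 n True ?X2 (insert c ?O2)"
      proof (cases "c = (a, g r2)")
        case True
        then show ?thesis using f2 r(3) T3 by (intro win_now[of "(r1, g r2)"]) auto
      next
        case False
        then show ?thesis using f1 T2 by (intro win_now[of "(a, g r2)"]) auto
      qed
    qed
  qed
  \<comment> \<open>Any move other than \<open>(r1, b)\<close> loses at once to \<open>T1\<close>;
    after \<open>(r1, b)\<close>, player 1 answers \<open>(r2, b)\<close>.\<close>
  have win2: "win1 n False ?X1 ?O1"
  proof (rule win1.move2)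
    have f1: "(r1, b) \<in> grid n - (?X1 \<union> ?O1)"
      using r gr free ab by (auto simp: grid_def)
    then show "grid n - (?X1 \<union> ?O1) \<noteq> {}" by blast
    show "\<forall>c\<in>grid n - (?X1 \<union> ?O1). \<not> has_transversal n (insert c ?O1) \<and>
        win1 n True ?X1 (insert c ?O1)"
    proof (intro ballI conjI)
      fix c
      show "\<not> has_transversal n (insert c ?O1)" using F(1) by (intro no_O) auto
      show "win1 n True ?X1 (insert c ?O1)"
      proof (cases "c = (r1, b)")
        case True
        have "(r2, b) \<in> grid n - (?X1 \<union> ?O2)"
          using r gr free ab by (auto simp: grid_def)
        then show ?thesis using win3 True by (auto intro: win1.move1)
      next
        case False
        then show ?thesis using f1 T1 by (intro win_now[of "(r1, b)"]) auto
      qed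
    qed
  qed
  show ?thesis
  proof (rule win1.move2)
    have f1: "(a, b) \<in> grid n - (?X \<union> F)" using ab by (auto simp: grid_def)
    then show "grid n - (?X \<union> F) \<noteq> {}" by blast
    show "\<forall>c\<in>grid n - (?X \<union> F). \<not> has_transversal n (insert c F) \<and> win1 n True ?X (insert c F)"
    proof (intro ballI conjI)
      fix c
      show "\<not> has_transversal n (insert c F)" using F(1) by (intro no_O) auto
      show "win1 n True ?X (insert c F)"
      proof (cases "c = (a, b)")
        case True
        have "(a, g r1) \<in> grid n - (?X \<union> ?O1)"
          using r gr free ab by (auto simp: grid_def)
        then show ?thesis using win2 True by (auto intro: win1.move1)
      next
        case False
        then show ?thesis using f1 T0 by (intro win_now[of "(a, b)"]) auto
      qed
    qed
  qed
qed

text \<open>Counting supplies the two auxiliary rows: the \<open>n - 2\<close> O cells cannot meet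
  all \<open>n - 1\<close> rows other than \<open>a\<close>, so some \<open>r1\<close> is free of O.
  Since column \<open>b\<close> already contains an O, inserting \<open>b\<close> adds no column,
  and the column bound follows from \<open>card F\<close>.\<close>

lemma win1_one_missing_clean_row:
  assumes g: "inj_on g ({..<n} - {a})" "g ` ({..<n} - {a}) = {..<n} - {b}"
    and ab: "a < n" "b < n"
    and F: "finite F" "card F + 2 = n"
    and row: "\<And>c. (a, c) \<notin> F"
    and col: "(p, b) \<in> F" "(s, t) \<in> F" "t \<noteq> b"
  shows "win1 n False (graph_on g ({..<n} - {a})) F"
proof -
  have "\<not> {..<n} - {a} \<subseteq> fst ` F"
  proof
    assume "{..<n} - {a} \<subseteq> fst ` F"
    then have "card ({..<n} - {a}) \<le> card (fst ` F)" using F(1) by (simp add: card_mono)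
    also have "\<dots> \<le> card F" using F(1) by (rule card_image_le)
    finally show False using F(2) ab by simp
  qed
  then obtain r1 where r1: "r1 < n" "r1 \<noteq> a" "\<And>c. (r1, c) \<notin> F"
    by (force simp: image_iff)
  \<comment> \<open>Without \<open>(s, t)\<close> only \<open>n - 3\<close> O cells face the
    remaining \<open>n - 2\<close> rows. The row missed by them can contain no O except
    \<open>(s, t)\<close>, which is outside column \<open>b\<close>; hence \<open>(r2, b)\<close> is
    free.\<close>
  have "\<not> {..<n} - {a, r1} \<subseteq> fst ` (F - {(s, t)})"
  proof
    assume "{..<n} - {a, r1} \<subseteq> fst ` (F - {(s, t)})"
    then have "card ({..<n} - {a, r1}) \<le> card (fst ` (F - {(s, t)}))"
      using F(1) by (simp add: card_mono)
    also have "\<dots> \<le> card (F - {(s, t)})" using F(1) by (simp add: card_image_le)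
    also have "\<dots> < card F" using F(1) col(2) by (meson card_Diff1_less)
    finally show False using F(2) ab r1 by (simp add: card_Diff_subset)
  qed
  then obtain r2 where r2: "r2 < n" "r2 \<noteq> a" "r2 \<noteq> r1" "(r2, b) \<notin> F"
    using col(3) by (force simp: image_iff)
  have "insert b (snd ` F) = snd ` F" using col(1) by force
  then have "card (insert b (snd ` F)) + 2 \<le> n"
    using card_image_le[OF F(1), of snd] F(2) by simp
  then show ?thesis
    using g ab row F(1) r1 r2 by (intro win1_one_missing[of g n a b F r1 r2]) auto
qed

section \<open>The move that leaves one missing cell\<close>

text \<open>The aim is to leave the clean row \<open>a'\<close> and a column containing an O, with
  another O outside that column. Playing in row \<open>a\<close> achieves this unless all O cells
  lie in column \<open>b\<close>; in that case player 1 occupies \<open>b\<close> himself.\<close>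

lemma win1_two_missing:
  assumes g: "inj_on g ({..<n} - {a, a'})" "g ` ({..<n} - {a, a'}) = {..<n} - {b, b'}"
    and n: "n \<ge> 4"
    and ab: "a < n" "a' < n" "a \<noteq> a'" "b < n" "b' < n" "b \<noteq> b'"
    and F: "finite F" "card F + 2 = n"
    and row': "\<And>c. (a', c) \<notin> F"
    and row: "\<And>c d. (a, c) \<in> F \<Longrightarrow> (a, d) \<in> F \<Longrightarrow> c = d"
    and col: "(p, b) \<in> F"
  shows "win1 n True (graph_on g ({..<n} - {a, a'})) F"
proof -
  let ?X = "graph_on g ({..<n} - {a, a'})"
  have eqs: "insert a ({..<n} - {a, a'}) = {..<n} - {a'}"
    "insert a' ({..<n} - {a, a'}) = {..<n} - {a}" using ab by auto
  \<comment> \<open>Stated for all four cells, because the cases below play \<open>(a, b')\<close>,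
    \<open>(a, b)\<close> and \<open>(a', b)\<close>.\<close>
  have upd: "inj_on (g(x := y)) (insert x ({..<n} - {a, a'}))"
    "(g(x := y)) ` insert x ({..<n} - {a, a'}) = insert y ({..<n} - {b, b'})"
    if "x \<in> {a, a'}" "y \<in> {b, b'}" for x y
  proof -
    have x: "x \<notin> {..<n} - {a, a'}" and y: "y \<notin> g ` ({..<n} - {a, a'})"
      using that unfolding g(2) by blast+
    have img: "(g(x := y)) ` ({..<n} - {a, a'}) = g ` ({..<n} - {a, a'})"
      using x by (intro image_cong) auto
    then show "(g(x := y)) ` insert x ({..<n} - {a, a'}) = insert y ({..<n} - {b, b'})"
      by (simp only: image_insert fun_upd_same g(2))
    show "inj_on (g(x := y)) (insert x ({..<n} - {a, a'}))"
      unfolding inj_on_insert using inj_on_fun_updI[OF g(1) y, of x] x y img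
      by (simp only: Diff_insert0 Diff_empty fun_upd_same simp_thms)
  qed
  have cols: "insert b ({..<n} - {b, b'}) = {..<n} - {b'}"
    "insert b' ({..<n} - {b, b'}) = {..<n} - {b}" using ab by auto
  have move: ?thesis
    if "x \<in> {a, a'}" "y \<in> {b, b'}" "(x, y) \<notin> F"
      "win1 n False (graph_on (g(x := y)) (insert x ({..<n} - {a, a'}))) F" for x y
  proof (rule win1.move1[of "(x, y)"])
    show "(x, y) \<in> grid n - (?X \<union> F)" using that ab by (auto simp: grid_def)
    show "win1 n False (insert (x, y) ?X) F"
      using that by (subst graph_on_upd) auto
  qed
  show ?thesis
  proof (cases "snd ` F \<subseteq> {b}")
    case False
    then obtain s t where st: "(s, t) \<in> F" "t \<noteq> b" by fastforce
    show ?thesis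
    proof (cases "(a, b') \<in> F")
      case False
      have "win1 n False (graph_on (g(a := b')) ({..<n} - {a'})) F"
        using upd[of a b'] ab F row' col st unfolding eqs cols
        by (intro win1_one_missing_clean_row[of _ n a' b F p s t]) auto
      then show ?thesis using False by (intro move[of a b', unfolded eqs]) simp_all
    next
      \<comment> \<open>Here the columns exchange roles: \<open>(a, b')\<close> is the O in the
        column left over, and \<open>(p, b)\<close> is the O outside it.\<close>
      case True
      then have "(a, b) \<notin> F" using row ab by blast
      moreover have "win1 n False (graph_on (g(a := b)) ({..<n} - {a'})) F"
        using upd[of a b] ab F row' col True unfolding eqs cols
        by (intro win1_one_missing_clean_row[of _ n a' b' F a p b]) auto
      ultimately show ?thesis by (intro move[of a b, unfolded eqs]) simp_all
    qed
  next
    case True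
    then have Fb: "t = b" if "(s, t) \<in> F" for s t using that by force
    have "card ({..<n} - {a, a'}) \<ge> 2" using ab n by (simp add: card_Diff_subset)
    then obtain B where "B \<subseteq> {..<n} - {a, a'}" "card B = 2" by (meson obtain_subset_with_card_n)
    then obtain r1 r2 where r: "r1 \<in> {..<n} - {a, a'}" "r2 \<in> {..<n} - {a, a'}" "r1 \<noteq> r2"
      by (auto simp: card_2_iff)
    then have gr: "g r1 \<noteq> b" "g r2 \<noteq> b" using g(2) by blast+
    \<comment> \<open>With all O cells in column \<open>b\<close>, no cell needed for the double
      threat around \<open>(a, b')\<close> is blocked. Two columns satisfy the bound because
      \<open>n\<close> is at least 4.\<close>
    have "card (insert b' (snd ` F)) \<le> card {b, b'}" using True by (intro card_mono) auto
    then have cF: "card (insert b' (snd ` F)) + 2 \<le> n" using ab n by simp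
    have "win1 n False (graph_on (g(a' := b)) ({..<n} - {a})) F"
    proof (rule win1_one_missing[of _ n a b' F r1 r2])
      show "inj_on (g(a' := b)) ({..<n} - {a})"
        "(g(a' := b)) ` ({..<n} - {a}) = {..<n} - {b'}"
        using upd[of a' b] unfolding eqs cols by simp_all
    qed (use ab F(1) cF r gr in \<open>auto dest: Fb\<close>)
    then show ?thesis using row' by (intro move[of a' b, unfolded eqs]) simp_all
  qed
qed

section \<open>Building the partial transversal\<close>

lemma win1_many_missing:
  assumes "inj_on g ({..<n} - R)" "g ` ({..<n} - R) = {..<n} - C"
    and "n \<ge> 4"
    and "R \<subseteq> {..<n}" "C \<subseteq> {..<n}" "card R = k + 2" "card C = k + 2" "a \<in> R" "b \<in> C"
    and "finite F" "card F + (k + 2) = n"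
    and "\<And>r c. r \<in> R - {a} \<Longrightarrow> (r, c) \<notin> F"
    and "\<And>c d. (a, c) \<in> F \<Longrightarrow> (a, d) \<in> F \<Longrightarrow> c = d"
    and "(p, b) \<in> F"
  shows "win1 n True (graph_on g ({..<n} - R)) F"
  using assms
proof (induction k arbitrary: g R C a F)
  case 0
  have "card (R - {a}) = 1" "card (C - {b}) = 1" using 0 by simp_all
  then obtain a' b' where "R - {a} = {a'}" "C - {b} = {b'}" by (auto simp: card_1_singleton_iff)
  then have RC: "R = {a, a'}" "a \<noteq> a'" "C = {b, b'}" "b \<noteq> b'" using 0 by auto
  show ?case
    using 0 RC unfolding RC(1) by (intro win1_two_missing[of g n a a' b b' F p]) auto
next
  case (Suc k)
  note fin = finite_subset[OF Suc.prems(4)] finite_subset[OF Suc.prems(5)]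
  let ?X = "graph_on g ({..<n} - R)"
  have "\<exists>y \<in> C - {b}. (a, y) \<notin> F"
  proof (rule ccontr)
    assume none: "\<not> ?thesis"
    have "card (C - {b}) \<ge> 2" using Suc.prems(7,9) by simp
    then obtain B where "B \<subseteq> C - {b}" "card B = 2" by (meson obtain_subset_with_card_n)
    then obtain c d where "c \<in> C - {b}" "d \<in> C - {b}" "c \<noteq> d" by (auto simp: card_2_iff)
    then show False using none Suc.prems(13) by blast
  qed
  then obtain y where y: "y \<in> C" "y \<noteq> b" "(a, y) \<notin> F" by auto
  let ?R = "R - {a}" and ?C = "C - {y}" and ?g = "g(a := y)"
  have an: "a < n" "y < n" using Suc.prems(4,5,8) y(1) by auto
  have ins: "insert a ({..<n} - R) = {..<n} - ?R" using an Suc.prems(8) by auto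
  have X': "insert (a, y) ?X = graph_on ?g ({..<n} - ?R)"
    using Suc.prems(8) by (simp add: graph_on_upd ins)
  have img: "?g ` ({..<n} - R) = {..<n} - C"
    using Suc.prems(2,8) by (metis DiffE fun_upd_other image_cong)
  have g': "?g ` ({..<n} - ?R) = {..<n} - ?C"
    unfolding ins[symmetric] using img an y by auto
  have "y \<notin> g ` ({..<n} - R)" using y(1) unfolding Suc.prems(2) by auto
  then have inj': "inj_on ?g ({..<n} - ?R)"
    unfolding ins[symmetric] using Suc.prems(1,8) by (auto simp: inj_on_def)
  have clean: "(r, c) \<notin> F" if "r \<in> ?R" for r c using that Suc.prems(12) by blast
  have cR: "card ?R = k + 2" "card ?C = k + 2" using Suc.prems y(1) by simp_all
  then have "?R \<noteq> {}" by (metis card.empty add_2_eq_Suc' nat.distinct(1))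
  then obtain r0 where r0: "r0 \<in> ?R" by blast
  show ?case
  proof (rule win1.move1[of "(a, y)"])
    show "(a, y) \<in> grid n - (?X \<union> F)" using an y Suc.prems(8) by (auto simp: grid_def)
    show "win1 n False (insert (a, y) ?X) F"
      unfolding X'
    proof (rule win1.move2)
      have "(r0, y) \<in> grid n - (graph_on ?g ({..<n} - ?R) \<union> F)"
        using r0 clean an Suc.prems(4) by (auto simp: grid_def)
      then show "grid n - (graph_on ?g ({..<n} - ?R) \<union> F) \<noteq> {}" by blast
      show "\<forall>c\<in>grid n - (graph_on ?g ({..<n} - ?R) \<union> F). \<not> has_transversal n (insert c F) \<and>
          win1 n True (graph_on ?g ({..<n} - ?R)) (insert c F)"
      proof (intro ballI conjI)
        fix e assume e: "e \<in> grid n - (graph_on ?g ({..<n} - ?R) \<union> F)"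
        have ce: "card (insert e F) = Suc (card F)" using e Suc.prems(10) by simp
        have "card (snd ` insert e F) \<le> card (insert e F)"
          using Suc.prems(10) by (intro card_image_le) simp
        then have "card (snd ` insert e F) < n" using ce Suc.prems(11) by simp
        then show "\<not> has_transversal n (insert e F)"
          using Suc.prems(10) by (intro no_transversal_few_columns) auto
        define a' where "a' = (if fst e \<in> ?R then fst e else r0)"
        have a': "a' \<in> ?R" using r0 by (simp add: a'_def)
        show "win1 n True (graph_on ?g ({..<n} - ?R)) (insert e F)"
        proof (rule Suc.IH[OF inj' g' Suc.prems(3) _ _ cR a'])
          show "b \<in> ?C" using Suc.prems(9) y by auto
          show "(p, b) \<in> insert e F" using Suc.prems(14) by simp
          show "card (insert e F) + (k + 2) = n" using ce Suc.prems(11) by simp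
          show "(r, c) \<notin> insert e F" if "r \<in> ?R - {a'}" for r c
            using that clean by (auto simp: a'_def split: if_splits)
          show "c = d" if "(a', c) \<in> insert e F" "(a', d) \<in> insert e F" for c d
            using that clean[OF a'] by auto
        qed (use Suc.prems in auto)
      qed
    qed
  qed
qed

section \<open>The opening\<close>

lemma win1_first_reply:
  assumes "n \<ge> 4" "p < n" "q < n" "q \<noteq> 0"
  shows "win1 n True {(0, 0)} {(p, q)}"
proof -
  let ?R = "{1..<n}" and ?a = "if p = 0 then 1 else p"
  have R0: "{..<n} - ?R = {0}" using assms(1) by auto
  have "win1 n True (graph_on (\<lambda>_. 0) ({..<n} - ?R)) {(p, q)}"
  proof (rule win1_many_missing[where C = ?R and k = "n - 3" and b = q and p = p and a = ?a])
    show "(r, c) \<notin> {(p, q)}" if "r \<in> ?R - {?a}" for r c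
      using that by (cases "p = 0") auto
    show "?a \<in> ?R" using assms by simp
    show "card ?R = n - 3 + 2" "card ?R = n - 3 + 2" "card {(p, q)} + (n - 3 + 2) = n"
      using assms(1) by simp_all
    show "inj_on (\<lambda>_. 0) ({..<n} - ?R)" "(\<lambda>_. 0) ` ({..<n} - ?R) = {..<n} - ?R"
      by (simp_all only: R0) simp_all
  qed (use assms in auto)
  then show ?thesis unfolding R0 by (simp add: graph_on_def)
qed

theorem theorem1:
  fixes n :: nat
  assumes "n \<ge> 4"
  shows "win1 n True {} {}"
proof (rule win1.move1[of "(0, 0)"])
  show "(0, 0) \<in> grid n - ({} \<union> {})" using assms by (simp add: grid_def)
  show "win1 n False {(0, 0)} {}"
  proof (rule win1.move2)
    have "(0, 1) \<in> grid n - ({(0, 0)} \<union> {})" using assms by (simp add: grid_def)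
    then show "grid n - ({(0, 0)} \<union> {}) \<noteq> {}" by blast
    show "\<forall>c\<in>grid n - ({(0, 0)} \<union> {}). \<not> has_transversal n {c} \<and> win1 n True {(0, 0)} {c}"
    proof (intro ballI conjI)
      fix c assume c: "c \<in> grid n - ({(0, 0)} \<union> {})"
      show "\<not> has_transversal n {c}" using assms by (intro no_transversal_few_columns) auto
      obtain p q where pq: "c = (p, q)" by fastforce
      have less: "p < n" "q < n" and ne: "p \<noteq> 0 \<or> q \<noteq> 0" using c by (auto simp: pq grid_def)
      show "win1 n True {(0, 0)} {c}"
      proof (cases "q = 0")
        case False
        then show ?thesis using win1_first_reply assms less by (simp add: pq)
      next
        \<comment> \<open>A reply in column 0 is not in row 0, so its transpose is outside column 0,
          while the first X at \<open>(0, 0)\<close> is fixed by transposition.\<close>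
        case True
        then have "win1 n True {(0, 0)} {(q, p)}" using win1_first_reply assms less ne by simp
        from win1_swap[OF this] show ?thesis by (simp add: pq)
      qed
    qed
  qed
qed

end
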